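(* Let $\kappa$ be a regular uncountable cardinal and $\lambda \geq \kappa$ a cardinal. Suppose that $\mathrm{cf}(\lambda) < \kappa$ and $PS^+((\mathrm{cf}(\lambda))^+, \kappa, \lambda)$ holds. Then $\mathrm{cov}(\lambda, \lambda, (\mathrm{cf}(\lambda))^+, 2) = \lambda^+$.
   Context: For a set $A$ and a cardinal $\tau$, $P_\tau(A) = \{a \subseteq A : |a| < \tau\}$. $I_{\kappa,\lambda}$ is the collection of all $A \subseteq P_\kappa(\lambda)$ such that for some $a \in P_\kappa(\lambda)$, no $b \in A$ satisfies $a \subseteq b$; $I_{\kappa,\lambda}^+$ is the collection of all $B \subseteq P_\kappa(\lambda)$ not in $I_{\kappa,\lambda}$ (i.e. the cofinal subsets of $(P_\kappa(\lambda),\subseteq)$). A partition of a set $X$ is a set of pairwise disjoint nonempty subsets of $X$ with union $X$. For an infinite cardinal $\tau \leq \kappa$, $PS^+(\tau,\kappa,\lambda)$ means: given, for each $a \in P_\kappa(\lambda)$, a partition $Q_a$ of $P_\kappa(\lambda)$ with $|Q_a| < \tau$, there are $B \in I_{\kappa,\lambda}^+$ and $h \in \prod_{a \in P_\kappa(\lambda)} Q_a$ such that for any $a, b \in B$, the set $\{c \in h(a) \cap h(b) : a \cup b \subseteq c\}$ is nonempty. Given four cardinals $\rho_1 \geq \rho_2 \geq \rho_3 \geq \omega$ and $\rho_3 \geq \rho_4 \geq 2$, $\mathrm{cov}(\rho_1,\rho_2,\rho_3,\rho_4)$ denotes the least cardinality of any $X \subseteq P_{\rho_2}(\rho_1)$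 such that for any $a \in P_{\rho_3}(\rho_1)$ there is $Q \in P_{\rho_4}(X)$ with $a \subseteq \bigcup Q$. *)

theory Defs
  imports Main "HOL-Library.FuncSet" "HOL-Library.Disjoint_Sets"
begin

unbundle cardinal_syntax

text \<open>
  A cardinal is a relation \<open>r\<close> with \<open>Card_order r\<close>, compared by \<open>\<le>o\<close>, \<open><o\<close> and \<open>=o\<close>;
  its underlying set of ordinals is \<open>Field r\<close>, and the order on that set is \<open>r\<close> itself.
\<close>

definition small_subsets :: "'t rel \<Rightarrow> 'a set \<Rightarrow> 'a set set" where
  "small_subsets t A = {a. a \<subseteq> A \<and> |a| <o t}"

text \<open>
  The least cardinality of a member of a nonempty family. The choice of the witness is
  irrelevant up to \<open>=o\<close>, and one exists because cardinals are well-ordered; for an empty family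
  the value is arbitrary.
\<close>

definition least_card :: "'a set set \<Rightarrow> 'a rel" where
  "least_card F = |SOME A. A \<in> F \<and> (\<forall>B\<in>F. |A| \<le>o |B| )|"

lemma least_card:
  assumes "F \<noteq> {}"
  shows "\<exists>A\<in>F. least_card F = |A|" and "\<And>B. B \<in> F \<Longrightarrow> least_card F \<le>o |B|"
proof -
  have "\<exists>r\<in>card_of ` F. \<forall>r'\<in>card_of ` F. r \<le>o r'"
    using assms by (intro exists_minim_Card_order) (auto simp: card_of_Card_order)
  then have "\<exists>A. A \<in> F \<and> (\<forall>B\<in>F. |A| \<le>o |B| )"
    by auto
  from someI_ex[OF this] show "\<exists>A\<in>F. least_card F = |A|"
    and "\<And>B. B \<in> F \<Longrightarrow> least_card F \<le>o |B|"
    by (auto simp: least_card_def)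
qed

text \<open>
  The library's \<open>cofinal\<close> asks for strict upper bounds, which makes no difference for an
  infinite cardinal, since it has no greatest element.
\<close>

definition cofinality :: "'a rel \<Rightarrow> 'a rel" where
  "cofinality r = least_card {A. A \<subseteq> Field r \<and> cofinal A r}"

definition noncofinal_families :: "'k rel \<Rightarrow> 'a rel \<Rightarrow> 'a set set set" where
  "noncofinal_families k l =
     {A. A \<subseteq> small_subsets k (Field l) \<and>
         (\<exists>a\<in>small_subsets k (Field l). \<not> (\<exists>b\<in>A. a \<subseteq> b))}"

definition cofinal_families :: "'k rel \<Rightarrow> 'a rel \<Rightarrow> 'a set set set" where
  "cofinal_families k l = {B. B \<subseteq> small_subsets k (Field l) \<and> B \<notin> noncofinal_families k l}"

definition PS_plus :: "'t rel \<Rightarrow> 'k rel \<Rightarrow> 'a rel \<Rightarrow> bool" where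
  "PS_plus t k l \<longleftrightarrow>
     (\<forall>Q :: 'a set \<Rightarrow> 'a set set set.
        (\<forall>a\<in>small_subsets k (Field l).
           partition_on (small_subsets k (Field l)) (Q a) \<and> |Q a| <o t) \<longrightarrow>
        (\<exists>B\<in>cofinal_families k l. \<exists>h\<in>(\<Pi>\<^sub>E a\<in>small_subsets k (Field l). Q a).
           \<forall>a\<in>B. \<forall>b\<in>B. {c \<in> h a \<inter> h b. a \<union> b \<subseteq> c} \<noteq> {}))"

text \<open>
  Meaningful for \<open>r1 \<ge> r2 \<ge> r3 \<ge> \<omega>\<close> and \<open>r3 \<ge> r4 \<ge> 2\<close>: then all of \<open>small_subsets r2 (Field r1)\<close>
  is itself a covering family, so the minimum is taken over a nonempty collection.
\<close>

definition cov :: "'a rel \<Rightarrow> 'b rel \<Rightarrow> 'c rel \<Rightarrow> 'd rel \<Rightarrow> 'a set rel" where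
  "cov r1 r2 r3 r4 = least_card
     {X. X \<subseteq> small_subsets r2 (Field r1) \<and>
         (\<forall>a\<in>small_subsets r3 (Field r1). \<exists>Q\<in>small_subsets r4 X. a \<subseteq> \<Union>Q)}"

end

theory Submission
  imports Defs
begin

text \<open>
  Write \<open>\<lambda>\<close> for the cardinal \<open>l\<close>, \<open>\<kappa>\<close> for \<open>k\<close>, and fix a cofinal \<open>C \<subseteq> \<lambda>\<close> with \<open>|C| = cf \<lambda> < \<kappa>\<close>.
  Since the fourth parameter of the covering number is \<open>2\<close>, a covering family is a set of
  subsets of \<open>\<lambda>\<close>, each of size less than \<open>\<lambda>\<close>, such that every subset of \<open>\<lambda>\<close> of size at most
  \<open>|C|\<close> lies inside a single member.

  The lower bound is a diagonal argument (\<open>small_sets_leave_gap\<close>): \<open>\<lambda>\<close> many sets of size less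
  than \<open>\<lambda>\<close> split into \<open>|C|\<close> many groups whose unions have size less than \<open>\<lambda>\<close>, and the set that
  consists of one missing point for each group lies inside none of them.

  For the upper bound, suppose that no family of size \<open>\<lambda>\<^sup>+\<close> is covering. Split every
  \<open>\<beta> < \<lambda>\<^sup>+\<close>, as a set of ordinals, into pieces \<open>A \<beta> i\<close> (\<open>i \<in> C\<close>) of size less than \<open>\<lambda>\<close>, and choose
  by recursion \<open>x \<alpha> : C \<rightarrow> \<lambda>\<close> (\<open>\<alpha> < \<lambda>\<^sup>+\<close>) whose range lies inside none of the \<open>\<lambda>\<^sup>+\<close> many sets
  \<open>\<Union>{range (x \<gamma>) | \<gamma> \<in> A \<beta> i, \<gamma> < \<alpha>}\<close>. For \<open>\<gamma> < \<beta>\<close> let \<open>i \<beta> \<gamma>\<close> name the piece that contains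
  \<open>\<gamma>\<close>, and let \<open>e \<beta> \<gamma> \<in> C\<close> be a coordinate at which \<open>x \<gamma>\<close> takes a value not taken by earlier
  terms of that piece. So below each \<open>\<beta>\<close> only \<open>|C|\<close> many labels \<open>(i, e)\<close> occur, and terms with
  the same label differ at the coordinate \<open>e\<close> (\<open>exists_free_sequence\<close>).

  This freeness has two uses. First, a set of size less than \<open>\<kappa>\<close> contains the range of fewer
  than \<open>\<kappa>\<close> terms (\<open>few_terms_inside_small_set\<close>), so the least strict upper bound \<open>rank a\<close> of the
  indices of the terms inside \<open>a\<close> defines a monotone and unbounded map from the subsets of \<open>\<lambda>\<close> of
  size less than \<open>\<kappa>\<close> to \<open>\<lambda>\<^sup>+\<close>. Second, for each \<open>a\<close>, colour the sets \<open>c \<supseteq> a\<close> by the label of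
  \<open>rank a\<close> below an ordinal \<open>top c > rank c\<close>. The partition hypothesis yields a cofinal family \<open>B\<close>
  and one colour for each member of \<open>B\<close> such that any two members see their colours at a common
  \<open>c\<close>. If two members have the same colour \<open>(i, e)\<close>, then the terms indexed by their ranks, when
  different, differ at \<open>e\<close>. So \<open>\<alpha> \<mapsto> x \<alpha> e\<close> embeds the ranks of each colour into \<open>\<lambda>\<close>, and with
  only \<open>|C|\<close> colours, \<open>B\<close> has at most \<open>\<lambda>\<close> many ranks. These are bounded in \<open>\<lambda>\<^sup>+\<close>, although \<open>B\<close>
  is cofinal and \<open>rank\<close> is unbounded.
\<close>

section \<open>Cardinals and cofinal sets\<close>

lemma ordLess_imp_ordLeq_underS:
  assumes "Well_order r" and "|A| <o r"
  shows "\<exists>j\<in>Field r. |A| \<le>o |underS r j|"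
proof -
  obtain j where j: "j \<in> Field r" and iso: "|A| =o Restr r (underS r j)"
    using assms ordLess_iff_ordIso_Restr[OF assms(1) card_of_Well_order] by blast
  have "|A| =o |Field (Restr r (underS r j))|"
    using card_of_cong[OF iso] by (simp add: Field_card_of)
  moreover have "Field (Restr r (underS r j)) \<subseteq> underS r j"
    by (auto simp: Field_def)
  ultimately show ?thesis
    using j card_of_mono1 ordIso_ordLeq_trans by blast
qed

lemma Times_ordLess_infinite:
  assumes r: "Card_order r" "infinite (Field r)" and AB: "|A| <o r" "|B| <o r"
  shows "|A \<times> B| <o r"
proof -
  let ?D = "A <+> B"
  have D: "|?D| <o r"
    by (rule card_of_Plus_ordLess_infinite_Field[OF r(2,1) AB])
  show ?thesis
  proof (cases "finite ?D")
    case True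
    then have "finite (A \<times> B)" by (simp add: finite_Plus_iff)
    then show ?thesis
      using r finite_ordLess_infinite[of "|A \<times> B|" r]
      by (simp add: Field_card_of card_of_well_order_on card_order_on_well_order_on)
  next
    case False
    have "|A \<times> B| \<le>o |?D \<times> ?D|"
      by (rule card_of_ordLeqI[of "map_prod Inl Inr"]) (auto simp: inj_on_def)
    also have "|?D \<times> ?D| =o |?D|"
      by (rule card_of_Times_same_infinite[OF False])
    also note D
    finally show ?thesis .
  qed
qed

text \<open>
  \<open>cofinal\<close> asks for strict upper bounds, so a cofinal set has no greatest element.
\<close>

lemma infinite_cofinal:
  assumes r: "Well_order r" and ne: "Field r \<noteq> {}" and sub: "C \<subseteq> Field r" and cof: "cofinal C r"
  shows "infinite C"
proof
  assume "finite C"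
  then have "\<exists>m\<in>Field r. \<forall>c\<in>C. (c, m) \<in> r"
    using sub
  proof (induction C)
    case empty
    then show ?case using ne by blast
  next
    case (insert c C)
    then obtain m where m: "m \<in> Field r" "\<forall>c\<in>C. (c, m) \<in> r" by blast
    have wo: "wo_rel r" using r by (simp add: wo_rel_def)
    have c: "c \<in> Field r" using insert.prems by blast
    show ?case
      using m c wo_rel.TRANS[OF wo] wo_rel.TOTALS[OF wo] wo_rel.REFL[OF wo]
      by (metis (no_types, lifting) insert_iff refl_onD transD)
  qed
  then obtain m where m: "m \<in> Field r" "\<forall>c\<in>C. (c, m) \<in> r" by blast
  with cof obtain b where "b \<in> C" "m \<noteq> b" "(m, b) \<in> r"
    unfolding cofinal_def by blast
  with m wo_rel.ANTISYM[of r] r show False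
    unfolding wo_rel_def antisym_def by blast
qed

lemma cofinality_witness:
  assumes "Card_order r" and "infinite (Field r)"
  shows "\<exists>C\<subseteq>Field r. cofinal C r \<and> infinite C \<and> cofinality r = |C|"
proof -
  have "cofinal (Field r) r"
    using infinite_Card_order_limit[OF assms] unfolding cofinal_def by blast
  then have "{A. A \<subseteq> Field r \<and> cofinal A r} \<noteq> {}" by blast
  from least_card(1)[OF this] obtain C where C: "C \<subseteq> Field r" "cofinal C r" "cofinality r = |C|"
    unfolding cofinality_def[symmetric] by auto
  have "Well_order r"
    using assms(1) by (rule card_order_on_well_order_on)
  moreover have "Field r \<noteq> {}"
    using assms(2) by auto
  ultimately have "infinite C"
    using C(1,2) by (rule infinite_cofinal)
  then show ?thesis using C by blast
qed

text \<open>
  Regularity of the successor of an infinite cardinal.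
\<close>

lemma AboveS_cardSuc_nonempty:
  assumes l: "Card_order l" and inf: "infinite (Field l)"
    and sub: "S \<subseteq> Field (cardSuc l)" and card: "|S| \<le>o l"
  shows "AboveS (cardSuc l) S \<noteq> {}"
proof -
  let ?L = "cardSuc l"
  have L: "Card_order ?L" "wo_rel ?L"
    using cardSuc_Card_order[OF l] cardSuc_Well_order[OF l] by (auto simp: wo_rel_def)
  have "\<not> |S| =o ?L"
    using card cardSuc_greater[OF l] by (meson not_ordLess_ordIso ordLeq_ordLess_trans)
  then have "\<not> cofinal S ?L"
    using infinite_cardSuc_regularCard[OF inf l] sub unfolding regularCard_def by blast
  then obtain a where a: "a \<in> Field ?L" "\<And>s. s \<in> S \<Longrightarrow> a = s \<or> (a, s) \<notin> ?L"
    unfolding cofinal_def by blast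
  have le: "(s, a) \<in> ?L" if "s \<in> S" for s
    using a that sub wo_rel.in_notinI[OF L(2)] by blast
  obtain b where b: "b \<in> Field ?L" "a \<noteq> b" "(a, b) \<in> ?L"
    using infinite_Card_order_limit[OF L(1) _ a(1)] cardSuc_finite[OF l] inf by blast
  have "s \<noteq> b \<and> (s, b) \<in> ?L" if "s \<in> S" for s
    using le[OF that] b wo_rel.TRANS[OF L(2)] wo_rel.ANTISYM[OF L(2)]
    unfolding antisym_def by (meson transD)
  then show ?thesis
    using b(1) unfolding AboveS_def by blast
qed

lemma in_small_subsets_cardSuc:
  assumes "Card_order r"
  shows "a \<in> small_subsets (cardSuc r) A \<longleftrightarrow> a \<subseteq> A \<and> |a| \<le>o r"
  by (simp add: small_subsets_def cardSuc_ordLeq_ordLess[OF assms card_of_Card_order])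

lemma small_subsets_ctwo:
  "Q \<in> small_subsets BNF_Cardinal_Arithmetic.ctwo X \<longleftrightarrow> Q = {} \<or> (\<exists>q\<in>X. Q = {q})"
proof -
  have "|Q| <o BNF_Cardinal_Arithmetic.ctwo \<longleftrightarrow> \<not> (\<exists>f. f ` Q = (UNIV :: bool set))"
    unfolding ctwo_def by (rule card_of_ordLess2[symmetric]) simp
  also have "\<dots> \<longleftrightarrow> Q = {} \<or> (\<exists>q. Q = {q})"
  proof
    assume no_surj: "\<not> (\<exists>f. f ` Q = (UNIV :: bool set))"
    show "Q = {} \<or> (\<exists>q. Q = {q})"
    proof (rule ccontr)
      assume "\<not> ?thesis"
      then obtain p q where "p \<in> Q" "q \<in> Q" "p \<noteq> q" by blast
      then have "(\<lambda>z. z = p) ` Q = UNIV"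
        by (auto simp: UNIV_bool image_iff)
      with no_surj show False by blast
    qed
  next
    assume "Q = {} \<or> (\<exists>q. Q = {q})"
    then show "\<not> (\<exists>f. f ` Q = (UNIV :: bool set))"
      by (auto simp: UNIV_bool)
  qed
  finally show ?thesis
    unfolding small_subsets_def by blast
qed

section \<open>The lower bound\<close>

text \<open>
  Number the members of \<open>X\<close> injectively by \<open>f : X \<rightarrow> \<lambda>\<close>, and let the group \<open>Y i j\<close> consist of
  those with number below \<open>i\<close> and with size at most that of \<open>j\<close>. For \<open>i, j \<in> C\<close> the union of the
  group has size less than \<open>\<lambda>\<close>, and every member of \<open>X\<close> is in some group because \<open>C\<close> is cofinal.
\<close>

lemma small_sets_leave_gap:
  assumes l: "Card_order l" and inf: "infinite (Field l)"
    and C: "C \<subseteq> Field l" "cofinal C l"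
    and X: "X \<subseteq> small_subsets l (Field l)" "|X| \<le>o l"
  shows "\<exists>a\<subseteq>Field l. a \<noteq> {} \<and> |a| \<le>o |C| \<and> (\<forall>x\<in>X. \<not> a \<subseteq> x)"
proof -
  have wo: "Well_order l" "wo_rel l" using l by (auto simp: card_order_on_well_order_on wo_rel_def)
  have infC: "infinite C"
    using infinite_cofinal[OF wo(1) _ C] inf by force
  have "|X| \<le>o |Field l|"
    using X(2) card_of_Field_ordIso[OF l] ordIso_symmetric ordLeq_ordIso_trans by blast
  then obtain f where f: "inj_on f X" "f ` X \<subseteq> Field l"
    using card_of_ordLeq[of X "Field l"] by blast
  define Y where "Y i j = {x \<in> X. f x \<in> underS l i \<and> |x| \<le>o |underS l j|}" for i j
  have gap: "\<exists>p\<in>Field l. p \<notin> \<Union>(Y i j)" if "i \<in> C" "j \<in> C" for i j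
  proof -
    have "|Y i j| \<le>o |underS l i|"
      using f(1) by (intro card_of_ordLeqI[of f]) (auto simp: Y_def inj_on_def)
    then have Y: "|Y i j| <o l"
      using card_of_underS[OF l] that C(1) ordLeq_ordLess_trans by blast
    have U: "|underS l j| <o l"
      using card_of_underS[OF l] that C(1) by blast
    have "|\<Union>(Y i j)| \<le>o |SIGMA x : Y i j. x|"
      using card_of_UNION_Sigma[of "\<lambda>x. x" "Y i j"] by simp
    also have "|SIGMA x : Y i j. x| \<le>o |Y i j \<times> underS l j|"
      by (rule card_of_Sigma_mono1) (simp add: Y_def)
    also have "|Y i j \<times> underS l j| <o l"
      using Times_ordLess_infinite[OF l inf Y U] .
    finally have "|\<Union>(Y i j)| <o l" .
    then have "\<not> Field l \<subseteq> \<Union>(Y i j)"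
      using card_of_mono1 card_of_Field_ordIso[OF l]
      by (meson not_ordLess_ordIso ordLeq_ordLess_trans)
    then show ?thesis by blast
  qed
  then obtain p where p: "\<And>i j. i \<in> C \<Longrightarrow> j \<in> C \<Longrightarrow> p i j \<in> Field l \<and> p i j \<notin> \<Union>(Y i j)"
    by metis
  define a where "a = (\<lambda>(i, j). p i j) ` (C \<times> C)"
  have "|a| \<le>o |C \<times> C|"
    unfolding a_def by (rule card_of_image)
  also have "|C \<times> C| =o |C|"
    by (rule card_of_Times_same_infinite[OF infC])
  finally have "|a| \<le>o |C|" .
  moreover have "a \<subseteq> Field l"
    using p by (auto simp: a_def)
  moreover have "a \<noteq> {}"
    using infC by (auto simp: a_def)
  moreover have "\<not> a \<subseteq> x" if x: "x \<in> X" for x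
  proof
    assume sub: "a \<subseteq> x"
    have above: "\<exists>i\<in>C. z \<in> underS l i" if "z \<in> Field l" for z
      using C(2) that unfolding cofinal_def underS_def by blast
    obtain i where i: "i \<in> C" "f x \<in> underS l i"
      using above f(2) x by blast
    have "|x| <o l" using X(1) x by (auto simp: small_subsets_def)
    then obtain z where z: "z \<in> Field l" "|x| \<le>o |underS l z|"
      using ordLess_imp_ordLeq_underS[OF wo(1)] by blast
    obtain j where j: "j \<in> C" "z \<in> underS l j"
      using above z(1) by blast
    have "underS l z \<subseteq> underS l j"
      using j(2) wo_rel.TRANS[OF wo(2)] wo_rel.ANTISYM[OF wo(2)]
      by (intro underS_incr) (auto simp: underS_def)
    then have "|x| \<le>o |underS l j|"
      using z(2) card_of_mono1 ordLeq_transitive by blast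
    then have "x \<in> Y i j" using x i by (simp add: Y_def)
    moreover have "p i j \<in> x" using sub i j by (auto simp: a_def)
    ultimately show False using p i j by blast
  qed
  ultimately show ?thesis by blast
qed

section \<open>A free sequence of length the successor cardinal\<close>

text \<open>
  Subsets of \<open>Field l\<close> of size at most \<open>|C|\<close> are given by enumerations \<open>x \<gamma>\<close> indexed by \<open>C\<close>, so that
  the coordinate \<open>e \<beta> \<gamma>\<close> of a distinguishing point comes from a set independent of \<open>\<gamma>\<close>. The
  injectivity condition has content because \<open>x\<close> does not depend on \<open>\<beta>\<close>: at most \<open>|C|\<close> labels
  \<open>(i \<beta> \<gamma>, e \<beta> \<gamma>)\<close> must separate all terms below any \<open>\<beta>\<close>.
\<close>

definition free_sequence ::
  "'a rel \<Rightarrow> 'a set \<Rightarrow> ('a set \<Rightarrow> 'a \<Rightarrow> 'a) \<Rightarrow> ('a set \<Rightarrow> 'a set \<Rightarrow> 'a) \<Rightarrow> ('a set \<Rightarrow> 'a set \<Rightarrow> 'a) \<Rightarrow> bool"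
  where
  "free_sequence l C x i e \<longleftrightarrow>
    (\<forall>\<gamma>. x \<gamma> ` C \<subseteq> Field l) \<and>
    (\<forall>\<beta>\<in>Field (cardSuc l).
      (\<forall>\<gamma>\<in>underS (cardSuc l) \<beta>. i \<beta> \<gamma> \<in> C \<and> e \<beta> \<gamma> \<in> C) \<and>
      inj_on (\<lambda>\<gamma>. (i \<beta> \<gamma>, x \<gamma> (e \<beta> \<gamma>))) (underS (cardSuc l) \<beta>))"

text \<open>
  The recursion can respect all \<open>\<beta> < \<lambda>\<^sup>+\<close> at once, including those above the current stage \<open>\<alpha>\<close>,
  because the sets to be avoided only involve terms before \<open>\<alpha>\<close> and there are at most
  \<open>\<lambda>\<^sup>+ \<cdot> |C| = \<lambda>\<^sup>+\<close> of them.
\<close>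

lemma exists_free_sequence:
  fixes l :: "'a rel"
  assumes l: "Card_order l" and inf: "infinite (Field l)"
    and C: "C \<subseteq> Field l" "cofinal C l" "|C| <o l"
    and uncovered: "\<And>X. X \<subseteq> small_subsets l (Field l) \<Longrightarrow> |X| \<le>o cardSuc l \<Longrightarrow>
      \<exists>a\<subseteq>Field l. |a| \<le>o |C| \<and> (\<forall>x\<in>X. \<not> a \<subseteq> x)"
  shows "\<exists>x i e. free_sequence l C x i e"
proof -
  define L where "L = cardSuc l"
  have wol: "Well_order l" "wo_rel l" using l by (auto simp: card_order_on_well_order_on wo_rel_def)
  have L: "Card_order L" "wo_rel L" "infinite (Field L)"
    using cardSuc_Card_order[OF l] cardSuc_Well_order[OF l] cardSuc_finite[OF l] inf
    by (auto simp: wo_rel_def L_def)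
  have infC: "infinite C"
    using infinite_cofinal[OF wol(1) _ C(1,2)] inf by force
  have Cne: "C \<noteq> {}" using infC by auto
  have "\<exists>g. inj_on g (underS L \<beta>) \<and> g ` underS L \<beta> \<subseteq> Field l" if "\<beta> \<in> Field L" for \<beta>
  proof -
    have "|underS L \<beta>| \<le>o l"
      using card_of_underS[OF L(1) that] cardSuc_ordLeq_ordLess[OF l card_of_Card_order]
      unfolding L_def by blast
    then have "|underS L \<beta>| \<le>o |Field l|"
      using card_of_Field_ordIso[OF l] ordIso_symmetric ordLeq_ordIso_trans by blast
    then show ?thesis using card_of_ordLeq[of "underS L \<beta>" "Field l"] by blast
  qed
  then obtain g where g: "\<And>\<beta>. \<beta> \<in> Field L \<Longrightarrow> inj_on (g \<beta>) (underS L \<beta>)"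
      "\<And>\<beta>. \<beta> \<in> Field L \<Longrightarrow> g \<beta> ` underS L \<beta> \<subseteq> Field l"
    by metis
  define A where "A \<beta> i = {\<gamma> \<in> underS L \<beta>. g \<beta> \<gamma> \<in> underS l i}" for \<beta> i
  have A_small: "|A \<beta> i| <o l" if "\<beta> \<in> Field L" "i \<in> C" for \<beta> i
  proof -
    have "|A \<beta> i| \<le>o |underS l i|"
      using g(1)[OF that(1)] by (intro card_of_ordLeqI[of "g \<beta>"]) (auto simp: A_def inj_on_def)
    then show ?thesis
      using card_of_underS[OF l] that(2) C(1) ordLeq_ordLess_trans by blast
  qed
  have A_cover: "\<exists>i\<in>C. \<gamma> \<in> A \<beta> i" if "\<beta> \<in> Field L" "\<gamma> \<in> underS L \<beta>" for \<beta> \<gamma>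
  proof -
    have "g \<beta> \<gamma> \<in> Field l" using g(2)[OF that(1)] that(2) by blast
    then show ?thesis using C(2) that(2) unfolding cofinal_def A_def underS_def by blast
  qed
  \<comment> \<open>the points of the terms of \<open>A \<beta> i\<close> that are already constructed at stage \<open>\<alpha>\<close>\<close>
  define U where "U f \<alpha> \<beta> i = (\<Union>\<gamma>\<in>{\<gamma>\<in>A \<beta> i. \<gamma> \<in> underS L \<alpha>}. f \<gamma> ` C)"
    for f :: "'a set \<Rightarrow> 'a \<Rightarrow> 'a" and \<alpha> \<beta> i
  define P where "P f \<alpha> y \<longleftrightarrow> y ` C \<subseteq> Field l \<and> (\<forall>\<beta>\<in>Field L. \<forall>i\<in>C. \<not> y ` C \<subseteq> U f \<alpha> \<beta> i)" for f \<alpha> y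
  have "\<exists>x. \<forall>\<alpha>. P x \<alpha> (x \<alpha>)"
  proof (rule dependent_wf_choice)
    show "wf (L - Id)" by (rule wo_rel.WF[OF L(2)])
    show "P f \<alpha> y = P f' \<alpha> y" if "\<And>z. (z, \<alpha>) \<in> L - Id \<Longrightarrow> f z = f' z" for f f' \<alpha> y
    proof -
      have "U f \<alpha> \<beta> i = U f' \<alpha> \<beta> i" for \<beta> i
        unfolding U_def using that by (intro SUP_cong) (auto simp: underS_def)
      then show ?thesis by (simp add: P_def)
    qed
    show "\<exists>y. P f \<alpha> y" if IH: "\<And>z. (z, \<alpha>) \<in> L - Id \<Longrightarrow> P f z (f z)" for \<alpha> f
    proof -
      define X where "X = (\<lambda>(\<beta>, i). U f \<alpha> \<beta> i) ` (Field L \<times> C)"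
      have "U f \<alpha> \<beta> i \<in> small_subsets l (Field l)" if "\<beta> \<in> Field L" "i \<in> C" for \<beta> i
      proof -
        have "U f \<alpha> \<beta> i \<subseteq> (\<lambda>(\<gamma>, c). f \<gamma> c) ` (A \<beta> i \<times> C)"
          unfolding U_def by auto
        then have "|U f \<alpha> \<beta> i| \<le>o |A \<beta> i \<times> C|"
          by (rule surj_imp_ordLeq)
        also have "|A \<beta> i \<times> C| <o l"
          using Times_ordLess_infinite[OF l inf A_small[OF that] C(3)] .
        finally have "|U f \<alpha> \<beta> i| <o l" .
        moreover have "U f \<alpha> \<beta> i \<subseteq> Field l"
          using IH unfolding U_def P_def underS_def by blast
        ultimately show ?thesis by (simp add: small_subsets_def)
      qed
      then have "X \<subseteq> small_subsets l (Field l)" by (auto simp: X_def)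
      moreover have "|X| \<le>o cardSuc l"
      proof -
        have "|C| \<le>o |Field L|"
          using C(3) cardSuc_greater[OF l] card_of_Field_ordIso[OF L(1)] unfolding L_def
          by (meson ordIso_symmetric ordLess_imp_ordLeq ordLess_transitive ordLeq_ordIso_trans)
        then have "|Field L \<times> C| =o |Field L|"
          using card_of_Times_infinite[OF L(3) Cne] by blast
        then have "|Field L \<times> C| =o L"
          using card_of_Field_ordIso[OF L(1)] ordIso_transitive by blast
        then show ?thesis
          unfolding X_def L_def using card_of_image ordLeq_ordIso_trans by blast
      qed
      ultimately obtain a where a: "a \<subseteq> Field l" "|a| \<le>o |C|" "\<And>x. x \<in> X \<Longrightarrow> \<not> a \<subseteq> x"
        using uncovered[of X] by meson
      have "Field L \<times> C \<noteq> {}" using L(3) Cne by auto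
      then have "a \<noteq> {}" using a(3) by (auto simp: X_def)
      then obtain y where "y ` C = a" using a(2) card_of_ordLeq2[of a C] by blast
      then show ?thesis
        using a unfolding P_def X_def by (intro exI[of _ y]) auto
    qed
  qed
  then obtain x where x: "\<And>\<alpha>. x \<alpha> ` C \<subseteq> Field l"
    "\<And>\<alpha> \<beta> i. \<beta> \<in> Field L \<Longrightarrow> i \<in> C \<Longrightarrow> \<not> x \<alpha> ` C \<subseteq> U x \<alpha> \<beta> i"
    unfolding P_def by metis
  have "\<exists>i\<in>C. \<exists>e\<in>C. \<gamma> \<in> A \<beta> i \<and> x \<gamma> e \<notin> U x \<gamma> \<beta> i" if b: "\<beta> \<in> Field L" "\<gamma> \<in> underS L \<beta>" for \<beta> \<gamma>
  proof -
    obtain j where j: "j \<in> C" "\<gamma> \<in> A \<beta> j"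
      using A_cover[OF b] by blast
    have "\<exists>e\<in>C. x \<gamma> e \<notin> U x \<gamma> \<beta> j"
      using x(2)[OF b(1) j(1), of \<gamma>] by (simp add: image_subset_iff)
    then show ?thesis using j by blast
  qed
  then obtain i e where ie: "\<And>\<beta> \<gamma>. \<beta> \<in> Field L \<Longrightarrow> \<gamma> \<in> underS L \<beta> \<Longrightarrow>
      i \<beta> \<gamma> \<in> C \<and> e \<beta> \<gamma> \<in> C \<and> \<gamma> \<in> A \<beta> (i \<beta> \<gamma>) \<and> x \<gamma> (e \<beta> \<gamma>) \<notin> U x \<gamma> \<beta> (i \<beta> \<gamma>)"
    by metis
  \<comment> \<open>The point of the later of two terms of one piece avoids the whole range of the earlier one.\<close>
  have fresh: "x \<gamma> (e \<beta> \<gamma>) \<noteq> x \<delta> (e \<beta> \<delta>)"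
    if \<beta>: "\<beta> \<in> Field L" and \<gamma>: "\<gamma> \<in> underS L \<beta>" and \<delta>: "\<delta> \<in> underS L \<beta>" and "i \<beta> \<gamma> = i \<beta> \<delta>"
      and "\<delta> \<noteq> \<gamma>" "(\<delta>, \<gamma>) \<in> L" for \<beta> \<gamma> \<delta>
  proof -
    have "\<delta> \<in> A \<beta> (i \<beta> \<gamma>)" "e \<beta> \<delta> \<in> C" "\<delta> \<in> underS L \<gamma>"
      using ie[OF \<beta> \<delta>] that by (auto simp: underS_def)
    then have "x \<delta> (e \<beta> \<delta>) \<in> U x \<gamma> \<beta> (i \<beta> \<gamma>)"
      unfolding U_def by blast
    then show ?thesis using ie[OF \<beta> \<gamma>] by metis
  qed
  have "inj_on (\<lambda>\<gamma>. (i \<beta> \<gamma>, x \<gamma> (e \<beta> \<gamma>))) (underS L \<beta>)" if \<beta>: "\<beta> \<in> Field L" for \<beta>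
  proof (rule inj_onI, rule ccontr)
    fix \<gamma> \<delta>
    assume *: "\<gamma> \<in> underS L \<beta>" "\<delta> \<in> underS L \<beta>"
      "(i \<beta> \<gamma>, x \<gamma> (e \<beta> \<gamma>)) = (i \<beta> \<delta>, x \<delta> (e \<beta> \<delta>))" "\<gamma> \<noteq> \<delta>"
    have "\<gamma> \<in> Field L" "\<delta> \<in> Field L" using * by (auto simp: underS_def Field_def)
    then have "(\<gamma>, \<delta>) \<in> L \<or> (\<delta>, \<gamma>) \<in> L" using wo_rel.TOTALS[OF L(2)] by blast
    then show False using fresh[OF \<beta>] * by (metis Pair_inject)
  qed
  then show ?thesis
    using x(1) ie unfolding free_sequence_def L_def[symmetric]
    by (intro exI[of _ x] exI[of _ i] exI[of _ e]) simp
qed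

text \<open>
  Otherwise \<open>\<kappa>\<close> many indices of such terms lie below one \<open>\<beta> < \<lambda>\<^sup>+\<close>, since \<open>\<kappa> \<le> \<lambda>\<close>, and then freeness
  embeds them into \<open>C \<times> a\<close>, a set of size less than \<open>\<kappa>\<close>.
\<close>

lemma few_terms_inside_small_set:
  fixes k :: "'k rel" and l :: "'a rel"
  assumes l: "Card_order l" and inf: "infinite (Field l)"
    and k: "Card_order k" "infinite (Field k)" "k \<le>o l" and C: "|C| <o k"
    and free: "free_sequence l C x i e"
    and a: "|a| <o k"
  shows "|{\<gamma> \<in> Field (cardSuc l). x \<gamma> ` C \<subseteq> a}| <o k"
proof (rule ccontr)
  let ?L = "cardSuc l" and ?S = "{\<gamma> \<in> Field (cardSuc l). x \<gamma> ` C \<subseteq> a}"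
  assume "\<not> |?S| <o k"
  then have "|Field k| \<le>o |?S|"
    using k(1) card_of_Field_ordIso[OF k(1)] not_ordLess_iff_ordLeq[of k "|?S|"]
    by (meson card_of_Well_order card_order_on_well_order_on ordIso_ordLeq_trans)
  then obtain T where T: "T \<subseteq> ?S" "|Field k| =o |T|"
    using internalize_card_of_ordLeq2[of "Field k" ?S] by blast
  then have Tk: "|T| =o k"
    using card_of_Field_ordIso[OF k(1)] by (meson ordIso_symmetric ordIso_transitive)
  then have "|T| \<le>o l"
    using k(3) ordIso_ordLeq_trans by blast
  then have "AboveS ?L T \<noteq> {}"
    using AboveS_cardSuc_nonempty[OF l inf] T(1) by blast
  then obtain \<beta> where \<beta>: "\<beta> \<in> Field ?L" "T \<subseteq> underS ?L \<beta>"
    unfolding AboveS_def underS_def by blast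
  have "|T| \<le>o |C \<times> a|"
  proof (rule card_of_ordLeqI)
    show "inj_on (\<lambda>\<gamma>. (i \<beta> \<gamma>, x \<gamma> (e \<beta> \<gamma>))) T"
      using free \<beta>(1) by (intro inj_on_subset[OF _ \<beta>(2)]) (simp add: free_sequence_def)
    show "(i \<beta> \<gamma>, x \<gamma> (e \<beta> \<gamma>)) \<in> C \<times> a" if "\<gamma> \<in> T" for \<gamma>
    proof -
      have "i \<beta> \<gamma> \<in> C" "e \<beta> \<gamma> \<in> C"
        using free \<beta> that by (auto simp: free_sequence_def)
      then show ?thesis using T(1) that by blast
    qed
  qed
  also have "|C \<times> a| <o k"
    using Times_ordLess_infinite[OF k(1,2) C a] .
  finally show False
    using Tk not_ordLess_ordIso by blast
qed

section \<open>The upper bound\<close>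

text \<open>
  The partition hypothesis in the form in which it is applied: a partition for each \<open>a\<close> is given
  by a colouring \<open>F a\<close>, and a choice of pieces by a choice of colours.
\<close>

lemma PS_plus_colouring:
  fixes k :: "'k rel" and l :: "'a rel" and F :: "'a set \<Rightarrow> 'a set \<Rightarrow> 'v"
  assumes PS: "PS_plus (cardSuc r) k l" and r: "Card_order r"
    and V: "|V| \<le>o r"
    and F: "\<And>a c. a \<in> small_subsets k (Field l) \<Longrightarrow> c \<in> small_subsets k (Field l) \<Longrightarrow> F a c \<in> V"
  shows "\<exists>B\<in>cofinal_families k l. \<exists>v. (\<forall>a\<in>B. v a \<in> V) \<and>
    (\<forall>a\<in>B. \<forall>b\<in>B. \<exists>c\<in>small_subsets k (Field l). a \<union> b \<subseteq> c \<and> F a c = v a \<and> F b c = v b)"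
proof -
  let ?P = "small_subsets k (Field l)"
  define piece where "piece a w = {c \<in> ?P. F a c = w}" for a w
  define Q where "Q a = piece a ` (F a ` ?P)" for a
  have Q: "partition_on ?P (Q a) \<and> |Q a| <o cardSuc r" if "a \<in> ?P" for a
  proof
    show "partition_on ?P (Q a)"
      by (rule partition_onI) (auto simp: Q_def piece_def disjnt_def)
    have "|Q a| \<le>o |F a ` ?P|"
      unfolding Q_def by (rule card_of_image)
    also have "|F a ` ?P| \<le>o |V|"
      using F[OF that] by (intro card_of_mono1) blast
    also note V
    finally show "|Q a| <o cardSuc r"
      using cardSuc_ordLeq_ordLess[OF r card_of_Card_order] by blast
  qed
  then have "\<forall>a\<in>?P. partition_on ?P (Q a) \<and> |Q a| <o cardSuc r"
    by blast
  from spec[OF PS[unfolded PS_plus_def], of Q, THEN mp, OF this]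
  obtain B h where B: "B \<in> cofinal_families k l" and h: "h \<in> (\<Pi>\<^sub>E a\<in>?P. Q a)"
    and meets: "\<forall>a\<in>B. \<forall>b\<in>B. {c \<in> h a \<inter> h b. a \<union> b \<subseteq> c} \<noteq> {}"
    by (elim bexE)
  have "B \<subseteq> ?P" using B by (simp add: cofinal_families_def)
  have "\<exists>w\<in>V. h a = piece a w" if "a \<in> B" for a
  proof -
    have a: "a \<in> ?P" using that \<open>B \<subseteq> ?P\<close> by blast
    have "h a \<in> Q a" using PiE_mem[OF h a] .
    then show ?thesis using F[OF a] by (auto simp: Q_def)
  qed
  then obtain v where v: "\<And>a. a \<in> B \<Longrightarrow> v a \<in> V \<and> h a = piece a (v a)"
    by metis
  have "\<exists>c\<in>?P. a \<union> b \<subseteq> c \<and> F a c = v a \<and> F b c = v b" if ab: "a \<in> B" "b \<in> B" for a b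
  proof -
    obtain c where "c \<in> h a" "c \<in> h b" "a \<union> b \<subseteq> c"
      using bspec[OF bspec[OF meets ab(1)] ab(2)] by blast
    then show ?thesis
      using v[OF ab(1)] v[OF ab(2)] by (auto simp: piece_def)
  qed
  then show ?thesis using B v by blast
qed

text \<open>
  The contradiction is that the ranks of a cofinal family are both bounded and unbounded in \<open>\<lambda>\<^sup>+\<close>.
\<close>

lemma PS_plus_imp_covering:
  fixes k :: "'k rel" and l :: "'a rel"
  assumes k: "Card_order k" "natLeq <o k" and l: "Card_order l" "k \<le>o l"
    and C: "C \<subseteq> Field l" "cofinal C l" "|C| <o k"
    and PS: "PS_plus (cardSuc |C| ) k l"
  shows "\<exists>X\<subseteq>small_subsets l (Field l). |X| \<le>o cardSuc l \<and>
    (\<forall>a\<subseteq>Field l. |a| \<le>o |C| \<longrightarrow> (\<exists>x\<in>X. a \<subseteq> x))"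
proof (rule ccontr)
  define L where "L = cardSuc l"
  let ?P = "small_subsets k (Field l)"
  assume "\<not> ?thesis"
  then have uncovered: "\<exists>a\<subseteq>Field l. |a| \<le>o |C| \<and> (\<forall>x\<in>X. \<not> a \<subseteq> x)"
    if "X \<subseteq> small_subsets l (Field l)" "|X| \<le>o cardSuc l" for X
    using that by meson
  have infk: "infinite (Field k)"
    using k by (meson card_of_ordLeq_finite cinfinite_def cinfinite_mono natLeq_cinfinite ordLess_imp_ordLeq)
  have infl: "infinite (Field l)"
    using l(2) infk by (meson cinfinite_def cinfinite_mono)
  have wol: "Well_order l" using l(1) by (simp add: card_order_on_well_order_on)
  have Cl: "|C| <o l" using C(3) l(2) ordLess_ordLeq_trans by blast
  have infC: "infinite C"
    using infinite_cofinal[OF wol _ C(1,2)] infl by force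
  have L: "Card_order L" "wo_rel L" "infinite (Field L)"
    using cardSuc_Card_order[OF l(1)] cardSuc_Well_order[OF l(1)] cardSuc_finite[OF l(1)] infl
    by (auto simp: wo_rel_def L_def)
  obtain x i e where free: "free_sequence l C x i e"
    using exists_free_sequence[OF l(1) infl C(1,2) Cl uncovered] by blast
  have x: "x \<gamma> ` C \<subseteq> Field l" for \<gamma>
    using free by (simp add: free_sequence_def)
  have ie: "i \<beta> \<gamma> \<in> C \<and> e \<beta> \<gamma> \<in> C" if "\<beta> \<in> Field L" "\<gamma> \<in> underS L \<beta>" for \<beta> \<gamma>
    using free that by (simp add: free_sequence_def L_def)
  have inj: "inj_on (\<lambda>\<gamma>. (i \<beta> \<gamma>, x \<gamma> (e \<beta> \<gamma>))) (underS L \<beta>)" if "\<beta> \<in> Field L" for \<beta>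
    using free that by (simp add: free_sequence_def L_def)
  define S where "S a = {\<gamma> \<in> Field L. x \<gamma> ` C \<subseteq> a}" for a
  define rank where "rank a = wo_rel.suc L (S a)" for a
  have S_mono: "S a \<subseteq> S c" if "a \<subseteq> c" for a c
    using that by (auto simp: S_def)
  have SL: "S a \<subseteq> Field L" for a by (auto simp: S_def)
  have bounded: "AboveS L (S a) \<noteq> {}" if "a \<in> ?P" for a
  proof -
    have "|S a| <o k"
      using few_terms_inside_small_set[OF l(1) infl k(1) infk l(2) C(3) free] that
      unfolding S_def L_def small_subsets_def by simp
    then have "|S a| \<le>o l"
      using l(2) ordLess_imp_ordLeq ordLess_ordLeq_trans by blast
    then show ?thesis
      using AboveS_cardSuc_nonempty[OF l(1) infl] SL unfolding L_def by blast
  qed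
  have rank_AboveS: "rank a \<in> AboveS L (S a)" if "a \<in> ?P" for a
    unfolding rank_def using wo_rel.suc_AboveS[OF L(2) SL bounded[OF that]] .
  have rank_Field: "rank a \<in> Field L" if "a \<in> ?P" for a
    using rank_AboveS[OF that] by (auto simp: AboveS_def)
  have rank_mono: "(rank a, rank c) \<in> L" if "a \<subseteq> c" "c \<in> ?P" for a c
  proof -
    have "rank c \<in> AboveS L (S a)"
      using rank_AboveS[OF that(2)] S_mono[OF that(1)] by (auto simp: AboveS_def)
    then show ?thesis
      unfolding rank_def[of a] by (rule wo_rel.suc_least_AboveS[OF L(2)])
  qed
  have "\<exists>\<beta>. a \<in> ?P \<longrightarrow> \<beta> \<in> Field L \<and> rank a \<noteq> \<beta> \<and> (rank a, \<beta>) \<in> L" for a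
    using infinite_Card_order_limit[OF L(1,3) rank_Field] by blast
  \<comment> \<open>The labels of the ranks of all subsets of \<open>c\<close> are compared below the one ordinal \<open>top c\<close>.\<close>
  then obtain top where top:
    "\<And>a. a \<in> ?P \<Longrightarrow> top a \<in> Field L \<and> rank a \<noteq> top a \<and> (rank a, top a) \<in> L"
    by metis
  have rank_underS: "rank a \<in> underS L (top c)" if "a \<subseteq> c" "c \<in> ?P" for a c
    using rank_mono[OF that] top[OF that(2)] wo_rel.TRANS[OF L(2)] wo_rel.ANTISYM[OF L(2)]
    unfolding underS_def antisym_def by (metis (mono_tags, lifting) mem_Collect_eq transD)
  obtain z where z: "z \<in> C" using infC by fastforce
  \<comment> \<open>Only supersets of \<open>a\<close> occur in the conclusion of the partition hypothesis, so the colour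
    \<open>(z, z)\<close> of the other sets is arbitrary.\<close>
  define F where "F a c = (if a \<subseteq> c then (i (top c) (rank a), e (top c) (rank a)) else (z, z))" for a c
  have F: "F a c \<in> C \<times> C" if "c \<in> ?P" for a c
    using ie[OF _ rank_underS[OF _ that]] top[OF that] z
    by (auto simp: F_def)
  have "|C \<times> C| \<le>o |C|"
    using card_of_Times_same_infinite[OF infC] ordIso_imp_ordLeq by blast
  then obtain B v where B: "B \<in> cofinal_families k l" and v: "\<And>a. a \<in> B \<Longrightarrow> v a \<in> C \<times> C"
    and meet: "\<And>a b. a \<in> B \<Longrightarrow> b \<in> B \<Longrightarrow>
      \<exists>c\<in>?P. a \<union> b \<subseteq> c \<and> F a c = v a \<and> F b c = v b"
    using PS_plus_colouring[OF PS card_of_Card_order, of "C \<times> C" F] F by metis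
  have BP: "B \<subseteq> ?P" using B by (simp add: cofinal_families_def)
  define Z where "Z w = rank ` {a \<in> B. v a = w}" for w
  have Z_small: "|Z w| \<le>o |Field l|" for w
  proof -
    obtain j d where w: "w = (j, d)" by (cases w)
    show ?thesis
    proof (cases "Z w = {}")
      case True
      then show ?thesis by (simp add: card_of_empty)
    next
      case False
      then have "d \<in> C" using v w by (force simp: Z_def)
      moreover have "inj_on (\<lambda>\<gamma>. x \<gamma> d) (Z w)"
      proof (rule inj_onI)
        fix \<gamma> \<delta>
        assume *: "\<gamma> \<in> Z w" "\<delta> \<in> Z w" "x \<gamma> d = x \<delta> d"
        obtain a b where ab: "a \<in> B" "v a = w" "\<gamma> = rank a" "b \<in> B" "v b = w" "\<delta> = rank b"
          using * by (auto simp: Z_def)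
        obtain c where c: "c \<in> ?P" "a \<subseteq> c" "b \<subseteq> c" "F a c = w" "F b c = w"
          using meet[OF ab(1,4)] ab(2,5) by auto
        have "(i (top c) \<gamma>, x \<gamma> (e (top c) \<gamma>)) = (i (top c) \<delta>, x \<delta> (e (top c) \<delta>))"
          using c ab * w by (auto simp: F_def)
        then show "\<gamma> = \<delta>"
          using inj_onD[OF inj] top[OF c(1)] rank_underS[OF _ c(1)] c ab by blast
      qed
      ultimately show ?thesis
        using x by (intro card_of_ordLeqI) auto
    qed
  qed
  have "|C \<times> C| \<le>o |Field l|"
    using \<open>|C \<times> C| \<le>o |C|\<close> C(1) card_of_mono1 ordLeq_transitive by blast
  then have "|\<Union>w\<in>C \<times> C. Z w| \<le>o |Field l|"
    using card_of_UNION_ordLeq_infinite[OF infl] Z_small by blast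
  moreover have "rank ` B \<subseteq> (\<Union>w\<in>C \<times> C. Z w)"
    using v by (auto simp: Z_def)
  ultimately have "|rank ` B| \<le>o l"
    using card_of_mono1 ordLeq_transitive card_of_Field_ordIso[OF l(1)] ordLeq_ordIso_trans by metis
  then have "AboveS L (rank ` B) \<noteq> {}"
    using AboveS_cardSuc_nonempty[OF l(1) infl] rank_Field BP unfolding L_def by blast
  then obtain \<alpha> where \<alpha>: "\<alpha> \<in> Field L" "\<And>a. a \<in> B \<Longrightarrow> rank a \<noteq> \<alpha> \<and> (rank a, \<alpha>) \<in> L"
    by (auto simp: AboveS_def)
  \<comment> \<open>A member of \<open>B\<close> that contains the range of \<open>x \<alpha>\<close> has rank above \<open>\<alpha>\<close>.\<close>
  have "x \<alpha> ` C \<in> ?P"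
    using x card_of_image[of "x \<alpha>" C] C(3) ordLeq_ordLess_trans
    by (auto simp: small_subsets_def)
  then obtain a where a: "a \<in> B" "x \<alpha> ` C \<subseteq> a"
    using B unfolding cofinal_families_def noncofinal_families_def by blast
  then have "\<alpha> \<in> S a" using \<alpha>(1) by (simp add: S_def)
  then have "(\<alpha>, rank a) \<in> L" using rank_AboveS BP a(1) by (auto simp: AboveS_def)
  then show False
    using \<alpha>(2)[OF a(1)] wo_rel.ANTISYM[OF L(2)] unfolding antisym_def by blast
qed

theorem theorem1p1:
  fixes k :: "'k rel" and l :: "'a rel"
  assumes "Card_order k" and "regularCard k" and "natLeq <o k"
    and "Card_order l" and "k \<le>o l"
    and "cofinality l <o k"
    and "PS_plus (cardSuc (cofinality l)) k l"
  shows "cov l l (cardSuc (cofinality l)) BNF_Cardinal_Arithmetic.ctwo =o cardSuc l"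
proof -
  note l = \<open>Card_order l\<close>
  have inf: "infinite (Field l)"
    using assms(3,5) cinfinite_def cinfinite_mono natLeq_cinfinite
    by (metis ordLess_imp_ordLeq ordLeq_transitive)
  obtain C where C: "C \<subseteq> Field l" "cofinal C l" "infinite C" "cofinality l = |C|"
    using cofinality_witness[OF l inf] by blast
  define covers where "covers X \<longleftrightarrow> X \<subseteq> small_subsets l (Field l) \<and>
    (\<forall>a\<in>small_subsets (cardSuc (cofinality l)) (Field l).
      \<exists>Q\<in>small_subsets BNF_Cardinal_Arithmetic.ctwo X. a \<subseteq> \<Union>Q)" for X
  have cov: "cov l l (cardSuc (cofinality l)) BNF_Cardinal_Arithmetic.ctwo = least_card {X. covers X}"
    by (simp add: cov_def covers_def)
  obtain X where X: "X \<subseteq> small_subsets l (Field l)" "|X| \<le>o cardSuc l"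
    "\<forall>a\<subseteq>Field l. |a| \<le>o |C| \<longrightarrow> (\<exists>x\<in>X. a \<subseteq> x)"
    using PS_plus_imp_covering[OF assms(1,3,4,5) C(1,2)] assms(6,7) C(4) by metis
  have "\<exists>Q\<in>small_subsets BNF_Cardinal_Arithmetic.ctwo X. a \<subseteq> \<Union>Q"
    if a: "a \<in> small_subsets (cardSuc (cofinality l)) (Field l)" for a
  proof -
    obtain q where "q \<in> X" "a \<subseteq> q"
      using a[unfolded C(4) in_small_subsets_cardSuc[OF card_of_Card_order]] X(3) by blast
    then show ?thesis
      by (intro bexI[of _ "{q}"]) (auto simp: small_subsets_ctwo)
  qed
  then have X_covers: "covers X" using X(1) by (simp add: covers_def)
  have upper: "least_card {X. covers X} \<le>o cardSuc l"
    using least_card(2)[of "{X. covers X}" X] X_covers X(2) ordLeq_transitive by blast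
  obtain Y where Y: "covers Y" "least_card {X. covers X} = |Y|"
    using least_card(1)[of "{X. covers X}"] X_covers by blast
  have "\<not> |Y| \<le>o l"
  proof
    assume "|Y| \<le>o l"
    then obtain a where a: "a \<subseteq> Field l" "a \<noteq> {}" "|a| \<le>o |C|" "\<And>y. y \<in> Y \<Longrightarrow> \<not> a \<subseteq> y"
      using small_sets_leave_gap[OF l inf C(1,2)] Y(1) unfolding covers_def by meson
    have "a \<in> small_subsets (cardSuc (cofinality l)) (Field l)"
      using a C(4) in_small_subsets_cardSuc[OF card_of_Card_order] by metis
    then obtain Q where Q: "Q \<in> small_subsets BNF_Cardinal_Arithmetic.ctwo Y" "a \<subseteq> \<Union>Q"
      using Y(1) unfolding covers_def by blast
    then show False
      using a(2,4) by (auto simp: small_subsets_ctwo)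
  qed
  then have "l <o |Y|"
    using not_ordLeq_iff_ordLess[OF _ card_of_Well_order, of l Y] l
    by (simp add: card_order_on_well_order_on)
  then have "cardSuc l \<le>o least_card {X. covers X}"
    using cardSuc_least[OF l card_of_Card_order] Y(2) by metis
  then show ?thesis
    using upper cov ordIso_iff_ordLeq by metis
qed

end
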